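(* Let $0\to\mathfrak{h}_S\xrightarrow{i}\mathfrak{e}_U\xrightarrow{p}\mathfrak{g}_T\to0$ be a non-abelian extension of Rota-Baxter Lie algebras, and let $(\chi,\psi,\Phi)$ be the non-abelian $2$-cocycle induced by a section $s$ of $p$. A pair of automorphisms $(\beta,\alpha)\in\mathrm{Aut}(\mathfrak{h}_S)\times\mathrm{Aut}(\mathfrak{g}_T)$ is inducible if and only if the non-abelian $2$-cocycles $(\chi_{(\beta,\alpha)},\psi_{(\beta,\alpha)},\Phi_{(\beta,\alpha)})$ and $(\chi,\psi,\Phi)$ are equivalent, that is, they correspond to the same element in $H^2_{nab}(\mathfrak{g}_T,\mathfrak{h}_S)$.
   Context: All vector spaces, linear maps and Lie algebras are over a field $\mathbf{k}$ of characteristic $0$. A Rota-Baxter Lie algebra $\mathfrak{g}_T$ is a Lie algebra $\mathfrak{g}$ with a linear map $T:\mathfrak{g}\to\mathfrak{g}$ satisfying $[T(x),T(y)]_\mathfrak{g}=T([T(x),y]_\mathfrak{g}+[x,T(y)]_\mathfrak{g})$ for all $x,y\in\mathfrak{g}$. A morphism $\mathfrak{g}_T\to\mathfrak{g}'_{T'}$ is a Lie algebra homomorphism $\varphi$ with $T'\circ\varphi=\varphi\circ T$; $\mathrm{Aut}(\mathfrak{g}_T)$ is the group of bijective morphisms $\mathfrak{g}_T\to\mathfrak{g}_T$. A non-abelian extension of $\mathfrak{g}_T$ by $\mathfrak{h}_S$ is a Rota-Baxter Lie algebra $\mathfrak{e}_U$ with a short exact sequence $0\to\mathfrak{h}_S\xrightarrow{i}\mathfrak{e}_U\xrightarrow{p}\mathfrak{g}_T\to0$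 of morphisms of Rota-Baxter Lie algebras; $\mathfrak{h}$ is identified with $i(\mathfrak{h})\subset\mathfrak{e}$. A section of $p$ is a linear map $s:\mathfrak{g}\to\mathfrak{e}$ with $p\circ s=\mathrm{id}_\mathfrak{g}$. A non-abelian $2$-cocycle of $\mathfrak{g}_T$ with values in $\mathfrak{h}_S$ is a triple $(\chi,\psi,\Phi)$ of linear maps $\chi:\wedge^2\mathfrak{g}\to\mathfrak{h}$, $\psi:\mathfrak{g}\to\mathrm{Der}(\mathfrak{h})$ (Lie derivations), $\Phi:\mathfrak{g}\to\mathfrak{h}$ such that for all $x,y,z\in\mathfrak{g}$, $h\in\mathfrak{h}$: (i) $\psi_x\psi_y(h)-\psi_y\psi_x(h)-\psi_{[x,y]_\mathfrak{g}}(h)=[\chi(x,y),h]_\mathfrak{h}$; (ii) $\psi_x\chi(y,z)+\psi_y\chi(z,x)+\psi_z\chi(x,y)-\chi([x,y]_\mathfrak{g},z)-\chi([y,z]_\mathfrak{g},x)-\chi([z,x]_\mathfrak{g},y)=0$; (iii) $\psi_{T(x)}S(h)=S(\psi_xS(h)+\psi_{T(x)}h)+S[\Phi(x),h]_\mathfrak{h}-[\Phi(x),S(h)]_\mathfrak{h}$; (iv) $\chi(T(x),T(y))-S(\chi(x,T(y))+\chi(T(x),y))-\Phi([x,T(y)]_\mathfrak{g}+[T(x),y]_\mathfrak{g})+\psi_{T(x)}\Phi(y)-\psi_{T(y)}\Phi(x)-S(\psi_x\Phi(y)-\psi_y\Phi(x))+[\Phi(x),\Phi(y)]_\mathfrak{h}=0$.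 Two such cocycles $(\chi,\psi,\Phi)$, $(\chi',\psi',\Phi')$ are equivalent if there is a linear map $\varphi:\mathfrak{g}\to\mathfrak{h}$ with $\psi_x(h)-\psi'_x(h)=[\varphi(x),h]_\mathfrak{h}$, $\chi(x,y)-\chi'(x,y)=\psi'_x(\varphi(y))-\psi'_y(\varphi(x))-\varphi([x,y]_\mathfrak{g})+[\varphi(x),\varphi(y)]_\mathfrak{h}$, $\Phi(x)-\Phi'(x)=S(\varphi(x))-\varphi(T(x))$ for all $x,y\in\mathfrak{g}$, $h\in\mathfrak{h}$. $H^2_{nab}(\mathfrak{g}_T,\mathfrak{h}_S)$ is the set of equivalence classes. The cocycle induced by a section $s$ of the extension is $\chi(x,y)=[s(x),s(y)]_\mathfrak{e}-s[x,y]_\mathfrak{g}$, $\psi_x(h)=[s(x),h]_\mathfrak{e}$, $\Phi(x)=U(s(x))-s(T(x))$. For $(\beta,\alpha)\in\mathrm{Aut}(\mathfrak{h}_S)\times\mathrm{Aut}(\mathfrak{g}_T)$ put $\chi_{(\beta,\alpha)}(x,y)=\beta\chi(\alpha^{-1}(x),\alpha^{-1}(y))$, $(\psi_{(\beta,\alpha)})_xh=\beta(\psi_{\alpha^{-1}(x)}\beta^{-1}(h))$, $\Phi_{(\beta,\alpha)}(x)=\beta\Phi(\alpha^{-1}(x))$; this triple is again a non-abelian $2$-cocycle. A pair $(\beta,\alpha)\in\mathrm{Aut}(\mathfrak{h}_S)\times\mathrm{Aut}(\mathfrak{g}_T)$ is inducible if there is $\gamma\in\mathrm{Aut}(\mathfrak{e}_U)$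 with $\gamma(\mathfrak{h})\subset\mathfrak{h}$, $\gamma|_\mathfrak{h}=\beta$ and $p\gamma s=\alpha$ (the map $p\gamma s$ does not depend on the section $s$). *)

theory Defs
  imports Complex_Main
begin

text \<open>
  A vector space is a whole type of class \<^class>\<open>ab_group_add\<close> together with a scalar
  multiplication. The record bundles it with a bracket and a Rota-Baxter operator; the
  axioms are imposed by the predicates below.
\<close>

record ('k, 'a) rb_lie =
  smul :: "'k \<Rightarrow> 'a \<Rightarrow> 'a"
  bracket :: "'a \<Rightarrow> 'a \<Rightarrow> 'a"
  rb_op :: "'a \<Rightarrow> 'a"

abbreviation bracket_syntax :: "'a \<Rightarrow> 'a \<Rightarrow> ('k, 'a) rb_lie \<Rightarrow> 'a"  ("[_, _]\<^bsub>_\<^esub>")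
  where "[x, y]\<^bsub>L\<^esub> \<equiv> bracket L x y"

abbreviation lin ::
  "('k::field_char_0, 'a::ab_group_add) rb_lie \<Rightarrow> ('k, 'b::ab_group_add) rb_lie \<Rightarrow> ('a \<Rightarrow> 'b) \<Rightarrow> bool"
  where "lin L M \<equiv> Vector_Spaces.linear (smul L) (smul M)"

text \<open>Linear maps \<open>\<wedge>\<^sup>2 L \<rightarrow> M\<close>, encoded as alternating bilinear maps.\<close>

definition alternating_bilinear ::
  "('k::field_char_0, 'a::ab_group_add) rb_lie \<Rightarrow> ('k, 'b::ab_group_add) rb_lie \<Rightarrow> ('a \<Rightarrow> 'a \<Rightarrow> 'b) \<Rightarrow> bool"
  where "alternating_bilinear L M f \<longleftrightarrow>
    (\<forall>y. lin L M (\<lambda>x. f x y)) \<and> (\<forall>x. lin L M (\<lambda>y. f x y)) \<and> (\<forall>x. f x x = 0)"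

definition lie_algebra :: "('k::field_char_0, 'a::ab_group_add) rb_lie \<Rightarrow> bool"
  where "lie_algebra L \<longleftrightarrow>
    vector_space (smul L) \<and>
    alternating_bilinear L L (bracket L) \<and>
    (\<forall>x y z. [x, [y, z]\<^bsub>L\<^esub>]\<^bsub>L\<^esub> + [y, [z, x]\<^bsub>L\<^esub>]\<^bsub>L\<^esub> + [z, [x, y]\<^bsub>L\<^esub>]\<^bsub>L\<^esub> = 0)"

definition rb_lie_algebra :: "('k::field_char_0, 'a::ab_group_add) rb_lie \<Rightarrow> bool"
  where "rb_lie_algebra L \<longleftrightarrow>
    lie_algebra L \<and>
    lin L L (rb_op L) \<and>
    (\<forall>x y. [rb_op L x, rb_op L y]\<^bsub>L\<^esub> = rb_op L ([rb_op L x, y]\<^bsub>L\<^esub> + [x, rb_op L y]\<^bsub>L\<^esub>))"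

definition rb_morphism ::
  "('k::field_char_0, 'a::ab_group_add) rb_lie \<Rightarrow> ('k, 'b::ab_group_add) rb_lie \<Rightarrow> ('a \<Rightarrow> 'b) \<Rightarrow> bool"
  where "rb_morphism L M f \<longleftrightarrow>
    lin L M f \<and>
    (\<forall>x y. f [x, y]\<^bsub>L\<^esub> = [f x, f y]\<^bsub>M\<^esub>) \<and>
    rb_op M \<circ> f = f \<circ> rb_op L"

definition rb_Aut :: "('k::field_char_0, 'a::ab_group_add) rb_lie \<Rightarrow> ('a \<Rightarrow> 'a) set"
  where "rb_Aut L = {f. rb_morphism L L f \<and> bij f}"

definition rb_extension ::
  "('k::field_char_0, 'g::ab_group_add) rb_lie \<Rightarrow> ('k, 'h::ab_group_add) rb_lie \<Rightarrow>
   ('k, 'e::ab_group_add) rb_lie \<Rightarrow> ('h \<Rightarrow> 'e) \<Rightarrow> ('e \<Rightarrow> 'g) \<Rightarrow> bool"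
  where "rb_extension g h e i p \<longleftrightarrow>
    rb_lie_algebra g \<and> rb_lie_algebra h \<and> rb_lie_algebra e \<and>
    rb_morphism h e i \<and> rb_morphism e g p \<and>
    inj i \<and> range i = {u. p u = 0} \<and> surj p"

definition is_section ::
  "('k::field_char_0, 'g::ab_group_add) rb_lie \<Rightarrow> ('k, 'e::ab_group_add) rb_lie \<Rightarrow>
   ('e \<Rightarrow> 'g) \<Rightarrow> ('g \<Rightarrow> 'e) \<Rightarrow> bool"
  where "is_section g e p s \<longleftrightarrow> lin g e s \<and> p \<circ> s = id"

definition derivation :: "('k::field_char_0, 'h::ab_group_add) rb_lie \<Rightarrow> ('h \<Rightarrow> 'h) \<Rightarrow> bool"
  where "derivation h D \<longleftrightarrow>
    lin h h D \<and> (\<forall>a b. D [a, b]\<^bsub>h\<^esub> = [D a, b]\<^bsub>h\<^esub> + [a, D b]\<^bsub>h\<^esub>)"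

type_synonym ('g, 'h) cochain = "('g \<Rightarrow> 'g \<Rightarrow> 'h) \<times> ('g \<Rightarrow> 'h \<Rightarrow> 'h) \<times> ('g \<Rightarrow> 'h)"

text \<open>
  The vector space structure of the space of derivations is pointwise, so linearity of
  \<open>\<psi>\<close> is linearity of \<open>x \<mapsto> \<psi> x a\<close> for every \<open>a\<close>.
\<close>

definition nab_cocycles ::
  "('k::field_char_0, 'g::ab_group_add) rb_lie \<Rightarrow> ('k, 'h::ab_group_add) rb_lie \<Rightarrow> ('g, 'h) cochain set"
  where "nab_cocycles g h = {(\<chi>, \<psi>, \<Phi>). (let T = rb_op g; S = rb_op h in
    alternating_bilinear g h \<chi> \<and>
    (\<forall>x. derivation h (\<psi> x)) \<and> (\<forall>a. lin g h (\<lambda>x. \<psi> x a)) \<and>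
    lin g h \<Phi> \<and>
    (\<forall>x y a. \<psi> x (\<psi> y a) - \<psi> y (\<psi> x a) - \<psi> [x, y]\<^bsub>g\<^esub> a = [\<chi> x y, a]\<^bsub>h\<^esub>) \<and>
    (\<forall>x y z. \<psi> x (\<chi> y z) + \<psi> y (\<chi> z x) + \<psi> z (\<chi> x y)
        - \<chi> [x, y]\<^bsub>g\<^esub> z - \<chi> [y, z]\<^bsub>g\<^esub> x - \<chi> [z, x]\<^bsub>g\<^esub> y = 0) \<and>
    (\<forall>x a. \<psi> (T x) (S a) =
        S (\<psi> x (S a) + \<psi> (T x) a) + S [\<Phi> x, a]\<^bsub>h\<^esub> - [\<Phi> x, S a]\<^bsub>h\<^esub>) \<and>
    (\<forall>x y. \<chi> (T x) (T y) - S (\<chi> x (T y) + \<chi> (T x) y)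
        - \<Phi> ([x, T y]\<^bsub>g\<^esub> + [T x, y]\<^bsub>g\<^esub>)
        + \<psi> (T x) (\<Phi> y) - \<psi> (T y) (\<Phi> x)
        - S (\<psi> x (\<Phi> y) - \<psi> y (\<Phi> x)) + [\<Phi> x, \<Phi> y]\<^bsub>h\<^esub> = 0))}"

definition nab_equiv ::
  "('k::field_char_0, 'g::ab_group_add) rb_lie \<Rightarrow> ('k, 'h::ab_group_add) rb_lie \<Rightarrow>
   (('g, 'h) cochain \<times> ('g, 'h) cochain) set"
  where "nab_equiv g h = {((\<chi>, \<psi>, \<Phi>), (\<chi>', \<psi>', \<Phi>')).
    (\<chi>, \<psi>, \<Phi>) \<in> nab_cocycles g h \<and> (\<chi>', \<psi>', \<Phi>') \<in> nab_cocycles g h \<and>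
    (\<exists>\<phi>. lin g h \<phi> \<and>
      (\<forall>x a. \<psi> x a - \<psi>' x a = [\<phi> x, a]\<^bsub>h\<^esub>) \<and>
      (\<forall>x y. \<chi> x y - \<chi>' x y =
          \<psi>' x (\<phi> y) - \<psi>' y (\<phi> x) - \<phi> [x, y]\<^bsub>g\<^esub> + [\<phi> x, \<phi> y]\<^bsub>h\<^esub>) \<and>
      (\<forall>x. \<Phi> x - \<Phi>' x = rb_op h (\<phi> x) - \<phi> (rb_op g x)))}"

definition H2_nab ::
  "('k::field_char_0, 'g::ab_group_add) rb_lie \<Rightarrow> ('k, 'h::ab_group_add) rb_lie \<Rightarrow> ('g, 'h) cochain set set"
  where "H2_nab g h = nab_cocycles g h // nab_equiv g h"

text \<open>
  The elements of \<open>e\<close> to which \<open>inv i\<close> is applied lie in the kernel of \<open>p\<close>, i.e. in the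
  range of \<open>i\<close>, so \<open>inv i\<close> is the identification of the range of \<open>i\<close> with \<open>h\<close>.
\<close>

definition induced_cocycle ::
  "('k, 'g::ab_group_add) rb_lie \<Rightarrow> ('k, 'e::ab_group_add) rb_lie \<Rightarrow>
   ('h \<Rightarrow> 'e) \<Rightarrow> ('g \<Rightarrow> 'e) \<Rightarrow> ('g, 'h) cochain"
  where "induced_cocycle g e i s =
    (\<lambda>x y. inv i ([s x, s y]\<^bsub>e\<^esub> - s [x, y]\<^bsub>g\<^esub>),
     \<lambda>x a. inv i [s x, i a]\<^bsub>e\<^esub>,
     \<lambda>x. inv i (rb_op e (s x) - s (rb_op g x)))"

definition twist :: "('h \<Rightarrow> 'h) \<Rightarrow> ('g \<Rightarrow> 'g) \<Rightarrow> ('g, 'h) cochain \<Rightarrow> ('g, 'h) cochain"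
  where "twist \<beta> \<alpha> = (\<lambda>(\<chi>, \<psi>, \<Phi>).
    (\<lambda>x y. \<beta> (\<chi> (inv \<alpha> x) (inv \<alpha> y)),
     \<lambda>x a. \<beta> (\<psi> (inv \<alpha> x) (inv \<beta> a)),
     \<lambda>x. \<beta> (\<Phi> (inv \<alpha> x))))"

text \<open>
  For \<open>\<gamma>\<close> preserving the range of \<open>i\<close> the map \<open>p \<circ> \<gamma> \<circ> s\<close> is the same for all sections
  \<open>s\<close>, and sections exist; hence quantifying over all of them is the same as choosing one.
\<close>

definition inducible ::
  "('k::field_char_0, 'g::ab_group_add) rb_lie \<Rightarrow> ('k, 'e::ab_group_add) rb_lie \<Rightarrow>
   ('h \<Rightarrow> 'e) \<Rightarrow> ('e \<Rightarrow> 'g) \<Rightarrow> ('h \<Rightarrow> 'h) \<Rightarrow> ('g \<Rightarrow> 'g) \<Rightarrow> bool"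
  where "inducible g e i p \<beta> \<alpha> \<longleftrightarrow>
    (\<exists>\<gamma> \<in> rb_Aut e. \<gamma> ` range i \<subseteq> range i \<and> \<gamma> \<circ> i = i \<circ> \<beta> \<and>
      (\<forall>s. is_section g e p s \<longrightarrow> p \<circ> \<gamma> \<circ> s = \<alpha>))"

end

theory Submission
  imports Defs
begin

text \<open>
  A pair of automorphisms does not act on the algebra \<open>e\<close> of an extension, but it does act on
  the two maps that make \<open>e\<close> an extension: \<open>(\<beta>, \<alpha>)\<close> turns
  \<open>h \<rightarrow>\<^sub>i e \<rightarrow>\<^sub>p g\<close> into \<open>h \<rightarrow> e \<rightarrow> g\<close> with the maps \<open>i \<circ> \<beta>\<^sup>-\<^sup>1\<close> and \<open>\<alpha> \<circ> p\<close>, again an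
  extension of \<open>g\<close> by \<open>h\<close> (\<open>twisted_extension\<close>). For the section \<open>s \<circ> \<alpha>\<^sup>-\<^sup>1\<close> its induced
  cocycle is exactly the twist by \<open>(\<beta>, \<alpha>)\<close> of the cocycle induced by \<open>s\<close>
  (\<open>induced_cocycle_twisted\<close>). In particular the twist is a cocycle because every induced
  triple is one (\<open>induced_cocycle_in_nab_cocycles\<close>).

  An automorphism \<open>\<gamma>\<close> of \<open>e\<close> that induces \<open>(\<beta>, \<alpha>)\<close> satisfies \<open>\<gamma> \<circ> i = i \<circ> \<beta>\<close> and
  \<open>p \<circ> \<gamma> = \<alpha> \<circ> p\<close>, and this says precisely that \<open>\<gamma>\<close> is an isomorphism from the twisted
  extension to the original one, compatible with the identities of \<open>h\<close> and \<open>g\<close>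
  (\<open>inducible_iff_isomorphic\<close>).

  The theorem thus becomes a case of the classification of extensions
  (\<open>isomorphic_iff_nab_equiv\<close>): two extensions with chosen sections are isomorphic in this sense
  if and only if the induced cocycles are equivalent. A section identifies the total space with
  \<open>g \<oplus> h\<close>, its bracket and Rota-Baxter operator being given by the cocycle. An isomorphism has
  to be of the form \<open>(x, a) \<mapsto> (x, \<phi> x + a)\<close>, and the three equations that make \<open>\<phi>\<close> an equivalence
  of cocycles express its compatibility with the brackets and the operators.

  Membership in a common class of \<open>H2_nab\<close> is the same as equivalence because \<open>nab_equiv\<close> is an
  equivalence relation on cocycles (\<open>nab_equiv_equiv\<close>).
\<close>

section \<open>Computing in Rota-Baxter Lie algebras\<close>

lemma lin_add: "lin L M f \<Longrightarrow> f (x + y) = f x + f y"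
  by (simp add: Vector_Spaces.linear_iff)

lemma lin_scale: "lin L M f \<Longrightarrow> f (smul L c x) = smul M c (f x)"
  by (simp add: Vector_Spaces.linear_iff)

lemma lin_zero: "lin L M f \<Longrightarrow> f 0 = 0"
  using lin_add[of L M f 0 0] by simp

lemma lin_minus: "lin L M f \<Longrightarrow> f (- x) = - f x"
  using lin_add[of L M f x "- x"] lin_zero[of L M f] by (simp add: minus_unique)

lemma lin_diff: "lin L M f \<Longrightarrow> f (x - y) = f x - f y"
  using lin_add[of L M f x "- y"] lin_minus[of L M f y] by simp

lemmas lin_simps = lin_add lin_zero lin_minus lin_diff

lemma linI:
  assumes "vector_space (smul L)" "vector_space (smul M)"
    and "\<And>x y. f (x + y) = f x + f y" "\<And>c x. f (smul L c x) = smul M c (f x)"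
  shows "lin L M f"
  using assms by (simp add: Vector_Spaces.linear_iff)

lemma lin_vector_space:
  assumes "lin L M f"
  shows "vector_space (smul L)" "vector_space (smul M)"
  using assms by (simp_all add: Vector_Spaces.linear_iff)

lemma smul_add: "vector_space (smul L) \<Longrightarrow> smul L c (x + y) = smul L c x + smul L c y"
  by (simp add: vector_space_def)

lemma smul_diff:
  assumes "vector_space (smul L)"
  shows "smul L c (x - y) = smul L c x - smul L c y"
  using smul_add[OF assms, of c "x - y" y] by (simp add: algebra_simps)

context
  fixes L :: "('k::field_char_0, 'a::ab_group_add) rb_lie"
  assumes L: "lie_algebra L"
begin

lemma bracket_lin: "lin L L (\<lambda>x. [x, y]\<^bsub>L\<^esub>)" "lin L L (\<lambda>y. [x, y]\<^bsub>L\<^esub>)"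
  using L by (simp_all add: lie_algebra_def alternating_bilinear_def)

lemma bracket_simps:
  "[x + x', y]\<^bsub>L\<^esub> = [x, y]\<^bsub>L\<^esub> + [x', y]\<^bsub>L\<^esub>" "[x, y + y']\<^bsub>L\<^esub> = [x, y]\<^bsub>L\<^esub> + [x, y']\<^bsub>L\<^esub>"
  "[x - x', y]\<^bsub>L\<^esub> = [x, y]\<^bsub>L\<^esub> - [x', y]\<^bsub>L\<^esub>" "[x, y - y']\<^bsub>L\<^esub> = [x, y]\<^bsub>L\<^esub> - [x, y']\<^bsub>L\<^esub>"
  "[- x, y]\<^bsub>L\<^esub> = - [x, y]\<^bsub>L\<^esub>" "[x, - y]\<^bsub>L\<^esub> = - [x, y]\<^bsub>L\<^esub>"
  using lin_simps[OF bracket_lin(1)] lin_simps[OF bracket_lin(2)] by simp_all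

lemma bracket_scale:
  "[smul L c x, y]\<^bsub>L\<^esub> = smul L c [x, y]\<^bsub>L\<^esub>" "[x, smul L c y]\<^bsub>L\<^esub> = smul L c [x, y]\<^bsub>L\<^esub>"
  using lin_scale[OF bracket_lin(1)] lin_scale[OF bracket_lin(2)] by simp_all

lemma bracket_self: "[x, x]\<^bsub>L\<^esub> = 0"
  using L by (simp add: lie_algebra_def alternating_bilinear_def)

lemma bracket_swap: "[y, x]\<^bsub>L\<^esub> = - [x, y]\<^bsub>L\<^esub>"
proof -
  have "[x, y]\<^bsub>L\<^esub> + [y, x]\<^bsub>L\<^esub> = [x + y, x + y]\<^bsub>L\<^esub>"
    by (simp only: bracket_simps) (simp add: bracket_self add.commute)
  also have "\<dots> = 0" by (rule bracket_self)
  finally have "[x, y]\<^bsub>L\<^esub> + [y, x]\<^bsub>L\<^esub> = 0" .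
  then show ?thesis by (simp add: minus_unique)
qed

lemma jacobi: "[x, [y, z]\<^bsub>L\<^esub>]\<^bsub>L\<^esub> + [y, [z, x]\<^bsub>L\<^esub>]\<^bsub>L\<^esub> + [z, [x, y]\<^bsub>L\<^esub>]\<^bsub>L\<^esub> = 0"
  using L by (simp add: lie_algebra_def)

text \<open>The Jacobi identity in Leibniz form: every bracketing is pushed to the right.\<close>

lemma bracket_leibniz: "[[x, y]\<^bsub>L\<^esub>, z]\<^bsub>L\<^esub> = [x, [y, z]\<^bsub>L\<^esub>]\<^bsub>L\<^esub> - [y, [x, z]\<^bsub>L\<^esub>]\<^bsub>L\<^esub>"
proof -
  have "- [z, [x, y]\<^bsub>L\<^esub>]\<^bsub>L\<^esub> = [x, [y, z]\<^bsub>L\<^esub>]\<^bsub>L\<^esub> + [y, [z, x]\<^bsub>L\<^esub>]\<^bsub>L\<^esub>"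
    using jacobi[of x y z] by (intro minus_unique) (simp add: algebra_simps)
  then show ?thesis
    by (simp add: bracket_swap[of "[x, y]\<^bsub>L\<^esub>" z] bracket_swap[of z x] bracket_simps)
qed

end

section \<open>Extensions with a section\<close>

text \<open>
  The section is part of the data, so that the cocycle becomes a function of the locale
  parameters and can be compared between two interpretations.
\<close>

locale sectioned_extension =
  fixes g :: "('k::field_char_0, 'g::ab_group_add) rb_lie"
    and h :: "('k, 'h::ab_group_add) rb_lie"
    and e :: "('k, 'e::ab_group_add) rb_lie"
    and i :: "'h \<Rightarrow> 'e" and p :: "'e \<Rightarrow> 'g" and s :: "'g \<Rightarrow> 'e"
  assumes extension: "rb_extension g h e i p"
    and sectioned: "is_section g e p s"
begin

abbreviation "T \<equiv> rb_op g"
abbreviation "S \<equiv> rb_op h"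
abbreviation "U \<equiv> rb_op e"

lemma lie: "lie_algebra g" "lie_algebra h" "lie_algebra e"
  using extension by (simp_all add: rb_extension_def rb_lie_algebra_def)

lemma lins: "lin g g T" "lin h h S" "lin e e U" "lin h e i" "lin e g p" "lin g e s"
  using extension sectioned by (simp_all add: rb_extension_def rb_lie_algebra_def rb_morphism_def is_section_def)

lemma vs: "vector_space (smul g)" "vector_space (smul h)" "vector_space (smul e)"
  using lins lin_vector_space by blast+

lemmas br_simps = bracket_simps[OF lie(1)] bracket_simps[OF lie(2)] bracket_simps[OF lie(3)]
lemmas map_simps = lin_simps[OF lins(1)] lin_simps[OF lins(2)] lin_simps[OF lins(3)]
  lin_simps[OF lins(4)] lin_simps[OF lins(5)] lin_simps[OF lins(6)]
lemmas scale_simps = lin_scale[OF lins(1)] lin_scale[OF lins(2)] lin_scale[OF lins(3)]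
  lin_scale[OF lins(4)] lin_scale[OF lins(5)] lin_scale[OF lins(6)]
  bracket_scale[OF lie(1)] bracket_scale[OF lie(2)] bracket_scale[OF lie(3)]
  smul_add[OF vs(1)] smul_add[OF vs(2)] smul_add[OF vs(3)]
  smul_diff[OF vs(1)] smul_diff[OF vs(2)] smul_diff[OF vs(3)]

lemma rota_baxter:
  "[T x, T y]\<^bsub>g\<^esub> = T ([T x, y]\<^bsub>g\<^esub> + [x, T y]\<^bsub>g\<^esub>)"
  "[U u, U v]\<^bsub>e\<^esub> = U ([U u, v]\<^bsub>e\<^esub> + [u, U v]\<^bsub>e\<^esub>)"
  using extension unfolding rb_extension_def rb_lie_algebra_def by blast+

lemma i_bracket: "i [a, b]\<^bsub>h\<^esub> = [i a, i b]\<^bsub>e\<^esub>"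
  and p_bracket: "p [u, v]\<^bsub>e\<^esub> = [p u, p v]\<^bsub>g\<^esub>"
  using extension by (simp_all add: rb_extension_def rb_morphism_def)

lemma i_op: "i (S a) = U (i a)"
  and p_op: "p (U u) = T (p u)"
  using extension by (simp_all add: rb_extension_def rb_morphism_def fun_eq_iff)

lemma i_eq_iff: "i a = i b \<longleftrightarrow> a = b"
  using extension by (auto simp: rb_extension_def dest: injD)

lemma p_i: "p (i a) = 0"
  using extension by (auto simp: rb_extension_def)

lemma p_s: "p (s x) = x"
  using sectioned by (simp add: is_section_def fun_eq_iff)

lemma i_inv: "p u = 0 \<Longrightarrow> i (inv i u) = u"
  using extension by (intro f_inv_into_f) (simp add: rb_extension_def)

text \<open>
  \<open>chi\<close>, \<open>psi\<close> and \<open>Phi\<close> are the components of the cocycle; \<open>proj\<close> is the linear retraction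
  of \<open>i\<close> determined by \<open>s\<close>, the \<open>h\<close>-coordinate in \<open>e = s(g) \<oplus> i(h)\<close>.
\<close>

definition "chi x y = inv i ([s x, s y]\<^bsub>e\<^esub> - s [x, y]\<^bsub>g\<^esub>)"
definition "psi x a = inv i [s x, i a]\<^bsub>e\<^esub>"
definition "Phi x = inv i (U (s x) - s (T x))"
definition "proj u = inv i (u - s (p u))"

lemma induced_cocycle_eq: "induced_cocycle g e i s = (chi, psi, Phi)"
  by (simp add: induced_cocycle_def chi_def psi_def Phi_def fun_eq_iff)

lemma i_chi: "i (chi x y) = [s x, s y]\<^bsub>e\<^esub> - s [x, y]\<^bsub>g\<^esub>"
  unfolding chi_def by (rule i_inv) (simp add: map_simps p_bracket p_s)

lemma i_psi: "i (psi x a) = [s x, i a]\<^bsub>e\<^esub>"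
  unfolding psi_def
  by (rule i_inv) (simp add: p_bracket p_i lin_zero[OF bracket_lin(2)[OF lie(1)]])

lemma i_Phi: "i (Phi x) = U (s x) - s (T x)"
  unfolding Phi_def by (rule i_inv) (simp add: map_simps p_op p_s)

lemma i_proj: "i (proj u) = u - s (p u)"
  unfolding proj_def by (rule i_inv) (simp add: map_simps p_s)

text \<open>
  Since \<open>i\<close> is injective, identities in \<open>h\<close> can be checked after applying \<open>i\<close>. There these rules
  remove every inverse of \<open>i\<close> and leave an identity between brackets and operators of \<open>e\<close>.
\<close>

lemmas i_simps = i_chi i_psi i_Phi i_proj i_bracket i_op

lemma decompose: "s (p u) + i (proj u) = u"
  by (simp add: i_proj)

lemma p_decomposed: "p (s x + i a) = x"
  by (simp add: map_simps p_s p_i)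

lemma proj_decomposed: "proj (s x + i a) = a"
  by (subst i_eq_iff[symmetric]) (simp add: i_proj p_decomposed)

lemma proj_lin: "lin e h proj"
  by (rule linI[OF vs(3,2)])
    (simp_all add: i_eq_iff[symmetric] i_simps map_simps scale_simps)

text \<open>
  The structure of \<open>e\<close> in the coordinates of \<open>g \<oplus> h\<close>: the cocycle is exactly what is needed to
  recover the bracket and the operator.
\<close>

lemma bracket_decomposed:
  "[s x + i a, s y + i b]\<^bsub>e\<^esub> = s [x, y]\<^bsub>g\<^esub> + i (chi x y + psi x b - psi y a + [a, b]\<^bsub>h\<^esub>)"
  by (simp add: br_simps map_simps i_simps bracket_swap[OF lie(3), of "i a" "s y"])

lemma op_decomposed: "U (s x + i a) = s (T x) + i (Phi x + S a)"
  by (simp add: map_simps i_simps)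

lemma psi_derivation: "derivation h (psi x)"
proof -
  have "lin h h (psi x)"
    by (rule linI[OF vs(2,2)])
      (simp_all add: i_eq_iff[symmetric] i_simps map_simps scale_simps br_simps)
  moreover have "psi x [a, b]\<^bsub>h\<^esub> = [psi x a, b]\<^bsub>h\<^esub> + [a, psi x b]\<^bsub>h\<^esub>" for a b
    by (simp add: i_eq_iff[symmetric] i_simps map_simps bracket_leibniz[OF lie(3)])
  ultimately show ?thesis by (simp add: derivation_def)
qed

lemma chi_alternating: "alternating_bilinear g h chi"
proof -
  have "lin g h (\<lambda>x. chi x y)" "lin g h (\<lambda>x. chi y x)" for y
    by (rule linI[OF vs(1,2)],
        simp_all add: i_eq_iff[symmetric] i_simps map_simps scale_simps br_simps)+
  moreover have "chi x x = 0" for x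
    by (simp add: i_eq_iff[symmetric] i_simps map_simps
        bracket_self[OF lie(1)] bracket_self[OF lie(3)])
  ultimately show ?thesis by (simp add: alternating_bilinear_def)
qed

lemma psi_lin: "lin g h (\<lambda>x. psi x a)"
  by (rule linI[OF vs(1,2)])
    (simp_all add: i_eq_iff[symmetric] i_simps map_simps scale_simps br_simps)

lemma Phi_lin: "lin g h Phi"
  by (rule linI[OF vs(1,2)])
    (simp_all add: i_eq_iff[symmetric] i_simps map_simps scale_simps)

text \<open>\<open>psi\<close> fails to be a representation by the curvature \<open>chi\<close> of \<open>s\<close>: the Jacobi identity
  for \<open>s x\<close>, \<open>s y\<close> and \<open>i a\<close>.\<close>

lemma psi_curvature:
  "psi x (psi y a) - psi y (psi x a) - psi [x, y]\<^bsub>g\<^esub> a = [chi x y, a]\<^bsub>h\<^esub>"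
  by (simp add: i_eq_iff[symmetric] i_simps map_simps br_simps bracket_leibniz[OF lie(3)])

text \<open>
  After applying \<open>i\<close>, the mixed brackets of some \<open>s x\<close> with some \<open>s [y, z]\<close> cancel, and what is
  left is the Jacobi sum in \<open>e\<close> minus the image under \<open>s\<close> of the Jacobi sum in \<open>g\<close>.
\<close>

lemma chi_bianchi:
  "psi x (chi y z) + psi y (chi z x) + psi z (chi x y)
    - chi [x, y]\<^bsub>g\<^esub> z - chi [y, z]\<^bsub>g\<^esub> x - chi [z, x]\<^bsub>g\<^esub> y = 0"
proof -
  have sw: "[s [a, b]\<^bsub>g\<^esub>, s c]\<^bsub>e\<^esub> = - [s c, s [a, b]\<^bsub>g\<^esub>]\<^bsub>e\<^esub>"
    "s [[a, b]\<^bsub>g\<^esub>, c]\<^bsub>g\<^esub> = - s [c, [a, b]\<^bsub>g\<^esub>]\<^bsub>g\<^esub>" for a b c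
    by (rule bracket_swap[OF lie(3)])
      (simp only: bracket_swap[OF lie(1), of "[a, b]\<^bsub>g\<^esub>" c] map_simps)
  have js: "s [x, [y, z]\<^bsub>g\<^esub>]\<^bsub>g\<^esub> + s [y, [z, x]\<^bsub>g\<^esub>]\<^bsub>g\<^esub> + s [z, [x, y]\<^bsub>g\<^esub>]\<^bsub>g\<^esub> = 0"
    using arg_cong[OF jacobi[OF lie(1), of x y z], of s] by (simp only: map_simps)
  have "i (psi x (chi y z) + psi y (chi z x) + psi z (chi x y)
      - chi [x, y]\<^bsub>g\<^esub> z - chi [y, z]\<^bsub>g\<^esub> x - chi [z, x]\<^bsub>g\<^esub> y)
    = ([s x, [s y, s z]\<^bsub>e\<^esub>]\<^bsub>e\<^esub> + [s y, [s z, s x]\<^bsub>e\<^esub>]\<^bsub>e\<^esub> + [s z, [s x, s y]\<^bsub>e\<^esub>]\<^bsub>e\<^esub>)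
      - (s [x, [y, z]\<^bsub>g\<^esub>]\<^bsub>g\<^esub> + s [y, [z, x]\<^bsub>g\<^esub>]\<^bsub>g\<^esub> + s [z, [x, y]\<^bsub>g\<^esub>]\<^bsub>g\<^esub>)"
    unfolding map_simps i_simps br_simps sw by (simp add: algebra_simps)
  then show ?thesis
    by (simp add: jacobi[OF lie(3)] js i_eq_iff[symmetric] map_simps)
qed

text \<open>
  The next two conditions are the Rota-Baxter identity of \<open>e\<close> for the pairs \<open>(s x, i a)\<close> and
  \<open>(s x, s y)\<close>, once \<open>s (T x)\<close> is replaced by \<open>U (s x) - i (Phi x)\<close>.
\<close>

lemma psi_rota_baxter:
  "psi (T x) (S a) = S (psi x (S a) + psi (T x) a) + S [Phi x, a]\<^bsub>h\<^esub> - [Phi x, S a]\<^bsub>h\<^esub>"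
proof -
  have sT: "s (T x) = U (s x) - i (Phi x)" by (simp add: i_Phi)
  show ?thesis
    unfolding i_eq_iff[symmetric] map_simps i_psi i_bracket i_op sT br_simps rota_baxter(2)
    by (simp add: algebra_simps)
qed

lemma Phi_rota_baxter:
  "chi (T x) (T y) - S (chi x (T y) + chi (T x) y) - Phi ([x, T y]\<^bsub>g\<^esub> + [T x, y]\<^bsub>g\<^esub>)
    + psi (T x) (Phi y) - psi (T y) (Phi x) - S (psi x (Phi y) - psi y (Phi x))
    + [Phi x, Phi y]\<^bsub>h\<^esub> = 0"
proof -
  define w where "w = [x, T y]\<^bsub>g\<^esub> + [T x, y]\<^bsub>g\<^esub>"
  have sT: "s (T x) = U (s x) - i (Phi x)" for x by (simp add: i_Phi)
  \<comment> \<open>By the Rota-Baxter identity of \<open>g\<close>, the two occurrences of \<open>s (T w)\<close>, from \<open>chi\<close> and from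
    \<open>Phi w\<close>, cancel.\<close>
  have Tw: "[T x, T y]\<^bsub>g\<^esub> = T w" by (simp add: rota_baxter w_def add.commute)
  have sw: "s w = s [x, T y]\<^bsub>g\<^esub> + s [T x, y]\<^bsub>g\<^esub>" by (simp add: w_def map_simps)
  have swap: "[U (s y), i (Phi x)]\<^bsub>e\<^esub> = - [i (Phi x), U (s y)]\<^bsub>e\<^esub>"
    "[i (Phi y), i (Phi x)]\<^bsub>e\<^esub> = - [i (Phi x), i (Phi y)]\<^bsub>e\<^esub>"
    "[s y, i (Phi x)]\<^bsub>e\<^esub> = - [i (Phi x), s y]\<^bsub>e\<^esub>"
    by (rule bracket_swap[OF lie(3)])+
  show ?thesis
    unfolding w_def[symmetric] i_eq_iff[symmetric] map_simps i_psi i_bracket i_op i_chi Tw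
      i_Phi[of w] sw
    unfolding sT[of x] sT[of y] br_simps map_simps swap rota_baxter(2)
    by (simp add: map_simps algebra_simps)
qed

lemma induced_cocycle_in_nab_cocycles: "(chi, psi, Phi) \<in> nab_cocycles g h"
  unfolding nab_cocycles_def Let_def
  using chi_alternating psi_derivation psi_lin Phi_lin psi_curvature chi_bianchi psi_rota_baxter
    Phi_rota_baxter by blast

end

section \<open>Equivalent cocycles are isomorphic extensions\<close>

text \<open>
  The map \<open>\<phi>\<close> measures by how much an isomorphism \<open>\<gamma>\<close> fails to carry one section to the other:
  \<open>\<gamma> (s1 x) = s2 x + i2 (\<phi> x)\<close>. Applying \<open>\<gamma>\<close> to the equations that define the first cocycle
  turns them into the equations of an equivalence. Conversely \<open>\<phi>\<close> determines
  \<open>\<gamma> (s1 x + i1 a) = s2 x + i2 (\<phi> x + a)\<close>, whose inverse is obtained from \<open>- \<phi>\<close>, and the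
  computation reads backwards.
\<close>

lemma isomorphic_iff_nab_equiv:
  fixes g :: "('k::field_char_0, 'g::ab_group_add) rb_lie"
    and h :: "('k, 'h::ab_group_add) rb_lie"
    and e1 :: "('k, 'e1::ab_group_add) rb_lie" and e2 :: "('k, 'e2::ab_group_add) rb_lie"
  assumes "sectioned_extension g h e1 i1 p1 s1" "sectioned_extension g h e2 i2 p2 s2"
  shows "(\<exists>\<gamma>. rb_morphism e1 e2 \<gamma> \<and> bij \<gamma> \<and> \<gamma> \<circ> i1 = i2 \<and> p2 \<circ> \<gamma> = p1) \<longleftrightarrow>
    (induced_cocycle g e1 i1 s1, induced_cocycle g e2 i2 s2) \<in> nab_equiv g h"
proof -
  interpret A: sectioned_extension g h e1 i1 p1 s1 by fact
  interpret B: sectioned_extension g h e2 i2 p2 s2 by fact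
  have equiv_iff: "(induced_cocycle g e1 i1 s1, induced_cocycle g e2 i2 s2) \<in> nab_equiv g h \<longleftrightarrow>
    (\<exists>\<phi>. lin g h \<phi> \<and>
      (\<forall>x a. A.psi x a - B.psi x a = [\<phi> x, a]\<^bsub>h\<^esub>) \<and>
      (\<forall>x y. A.chi x y - B.chi x y =
          B.psi x (\<phi> y) - B.psi y (\<phi> x) - \<phi> [x, y]\<^bsub>g\<^esub> + [\<phi> x, \<phi> y]\<^bsub>h\<^esub>) \<and>
      (\<forall>x. A.Phi x - B.Phi x = rb_op h (\<phi> x) - \<phi> (rb_op g x)))"
    by (simp add: A.induced_cocycle_eq B.induced_cocycle_eq nab_equiv_def
        A.induced_cocycle_in_nab_cocycles B.induced_cocycle_in_nab_cocycles)
  show ?thesis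
    unfolding equiv_iff
  proof (intro iffI; elim exE conjE)
    fix \<gamma> assume mor: "rb_morphism e1 e2 \<gamma>" and comp: "\<gamma> \<circ> i1 = i2" "p2 \<circ> \<gamma> = p1"
    have \<gamma>_lin: "lin e1 e2 \<gamma>" and \<gamma>_bracket: "\<gamma> [u, v]\<^bsub>e1\<^esub> = [\<gamma> u, \<gamma> v]\<^bsub>e2\<^esub>"
      and \<gamma>_op: "\<gamma> (rb_op e1 u) = rb_op e2 (\<gamma> u)" for u v
      using mor by (simp_all add: rb_morphism_def fun_eq_iff)
    note \<gamma>_simps = lin_simps[OF \<gamma>_lin]
    have \<gamma>_i: "\<gamma> (i1 a) = i2 a" and p_\<gamma>: "p2 (\<gamma> u) = p1 u" for a u
      using comp by (simp_all add: fun_eq_iff)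
    define \<phi> where "\<phi> x = B.proj (\<gamma> (s1 x))" for x
    have \<gamma>_s: "\<gamma> (s1 x) = s2 x + i2 (\<phi> x)" for x
      using B.decompose[of "\<gamma> (s1 x)"] by (simp add: \<phi>_def p_\<gamma> A.p_s)
    have \<phi>_lin: "lin g h \<phi>"
      using Vector_Spaces.linear_compose[OF Vector_Spaces.linear_compose[OF A.lins(6) \<gamma>_lin] B.proj_lin]
      by (simp add: \<phi>_def[abs_def] comp_def)
    have "A.psi x a - B.psi x a = [\<phi> x, a]\<^bsub>h\<^esub>" for x a
    proof -
      have "i2 (A.psi x a) = [s2 x + i2 (\<phi> x), i2 a]\<^bsub>e2\<^esub>"
        using A.i_psi[of x a, THEN arg_cong, of \<gamma>] by (simp add: \<gamma>_i \<gamma>_bracket \<gamma>_s)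
      then show ?thesis
        by (simp add: B.i_eq_iff[symmetric] B.map_simps B.i_simps B.br_simps)
    qed
    moreover have "A.chi x y - B.chi x y =
        B.psi x (\<phi> y) - B.psi y (\<phi> x) - \<phi> [x, y]\<^bsub>g\<^esub> + [\<phi> x, \<phi> y]\<^bsub>h\<^esub>" for x y
    proof -
      have "i2 (A.chi x y) = [s2 x + i2 (\<phi> x), s2 y + i2 (\<phi> y)]\<^bsub>e2\<^esub> - (s2 [x, y]\<^bsub>g\<^esub> + i2 (\<phi> [x, y]\<^bsub>g\<^esub>))"
        using A.i_chi[of x y, THEN arg_cong, of \<gamma>] by (simp add: \<gamma>_i \<gamma>_bracket \<gamma>_s \<gamma>_simps)
      then have "i2 (A.chi x y) = i2 (B.chi x y + B.psi x (\<phi> y) - B.psi y (\<phi> x) + [\<phi> x, \<phi> y]\<^bsub>h\<^esub>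
          - \<phi> [x, y]\<^bsub>g\<^esub>)"
        unfolding B.bracket_decomposed B.map_simps by (simp add: algebra_simps)
      then show ?thesis by (simp add: B.i_eq_iff)
    qed
    moreover have "A.Phi x - B.Phi x = rb_op h (\<phi> x) - \<phi> (rb_op g x)" for x
    proof -
      have "i2 (A.Phi x) = rb_op e2 (s2 x + i2 (\<phi> x)) - (s2 (rb_op g x) + i2 (\<phi> (rb_op g x)))"
        using A.i_Phi[of x, THEN arg_cong, of \<gamma>] by (simp add: \<gamma>_i \<gamma>_op \<gamma>_s \<gamma>_simps)
      then have "i2 (A.Phi x) = i2 (B.Phi x + rb_op h (\<phi> x) - \<phi> (rb_op g x))"
        unfolding B.op_decomposed by (simp add: B.map_simps algebra_simps)
      then show ?thesis by (simp add: B.i_eq_iff)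
    qed
    ultimately show "\<exists>\<phi>. lin g h \<phi> \<and>
      (\<forall>x a. A.psi x a - B.psi x a = [\<phi> x, a]\<^bsub>h\<^esub>) \<and>
      (\<forall>x y. A.chi x y - B.chi x y =
          B.psi x (\<phi> y) - B.psi y (\<phi> x) - \<phi> [x, y]\<^bsub>g\<^esub> + [\<phi> x, \<phi> y]\<^bsub>h\<^esub>) \<and>
      (\<forall>x. A.Phi x - B.Phi x = rb_op h (\<phi> x) - \<phi> (rb_op g x))"
      using \<phi>_lin by blast
  next
    fix \<phi>
    assume \<phi>_lin: "lin g h \<phi>"
      and psi: "\<forall>x a. A.psi x a - B.psi x a = [\<phi> x, a]\<^bsub>h\<^esub>"
      and chi: "\<forall>x y. A.chi x y - B.chi x y =
          B.psi x (\<phi> y) - B.psi y (\<phi> x) - \<phi> [x, y]\<^bsub>g\<^esub> + [\<phi> x, \<phi> y]\<^bsub>h\<^esub>"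
      and Phi: "\<forall>x. A.Phi x - B.Phi x = rb_op h (\<phi> x) - \<phi> (rb_op g x)"
    note \<phi>_simps = lin_simps[OF \<phi>_lin]
    define \<gamma> where "\<gamma> u = s2 (p1 u) + i2 (\<phi> (p1 u) + A.proj u)" for u
    have \<gamma>: "\<gamma> (s1 x + i1 a) = s2 x + i2 (\<phi> x + a)" for x a
      by (simp add: \<gamma>_def A.p_decomposed A.proj_decomposed)
    have \<gamma>_lin: "lin e1 e2 \<gamma>"
      by (rule linI[OF A.vs(3) B.vs(3)])
        (simp_all add: \<gamma>_def A.map_simps B.map_simps \<phi>_simps lin_simps[OF A.proj_lin]
          A.scale_simps B.scale_simps lin_scale[OF \<phi>_lin] lin_scale[OF A.proj_lin])
    have "\<gamma> [u, v]\<^bsub>e1\<^esub> = [\<gamma> u, \<gamma> v]\<^bsub>e2\<^esub>" for u v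
    proof -
      define x a y b where "x = p1 u" "a = A.proj u" "y = p1 v" "b = A.proj v"
      then have uv: "u = s1 x + i1 a" "v = s1 y + i1 b" by (simp_all add: A.decompose)
      have psi': "A.psi x a = B.psi x a + [\<phi> x, a]\<^bsub>h\<^esub>" for x a
        using psi[rule_format, of x a] by (simp add: algebra_simps)
      have chi': "A.chi x y = B.chi x y +
          B.psi x (\<phi> y) - B.psi y (\<phi> x) - \<phi> [x, y]\<^bsub>g\<^esub> + [\<phi> x, \<phi> y]\<^bsub>h\<^esub>"
        using chi[rule_format, of x y] by (simp add: algebra_simps)
      have "\<phi> [x, y]\<^bsub>g\<^esub> + (A.chi x y + A.psi x b - A.psi y a + [a, b]\<^bsub>h\<^esub>)
        = B.chi x y + B.psi x (\<phi> y + b) - B.psi y (\<phi> x + a) + [\<phi> x + a, \<phi> y + b]\<^bsub>h\<^esub>"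
        using bracket_swap[OF A.lie(2), of "\<phi> y" a]
          B.psi_derivation by (simp add: psi' chi' A.br_simps derivation_def lin_simps[of h h "B.psi _"])
      then show ?thesis
        unfolding uv A.bracket_decomposed \<gamma> B.bracket_decomposed by (rule arg_cong)
    qed
    moreover have "rb_op e2 (\<gamma> u) = \<gamma> (rb_op e1 u)" for u
    proof -
      define x a where "x = p1 u" "a = A.proj u"
      then have u: "u = s1 x + i1 a" by (simp add: A.decompose)
      have "B.Phi x + rb_op h (\<phi> x + a) = \<phi> (rb_op g x) + (A.Phi x + rb_op h a)"
        using Phi[rule_format, of x] by (simp add: A.map_simps algebra_simps)
      then show ?thesis
        unfolding u A.op_decomposed \<gamma> B.op_decomposed by (rule arg_cong)
    qed
    ultimately have mor: "rb_morphism e1 e2 \<gamma>"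
      using \<gamma>_lin by (simp add: rb_morphism_def fun_eq_iff)
    have bij: "bij \<gamma>"
    proof (rule o_bij)
      define \<delta> where "\<delta> v = s1 (p2 v) + i1 (B.proj v - \<phi> (p2 v))" for v
      show "\<delta> \<circ> \<gamma> = id"
        by (simp add: fun_eq_iff \<delta>_def \<gamma>_def B.p_decomposed B.proj_decomposed A.decompose)
      show "\<gamma> \<circ> \<delta> = id"
        by (simp add: fun_eq_iff \<delta>_def \<gamma> B.decompose)
    qed
    have "\<gamma> \<circ> i1 = i2" "p2 \<circ> \<gamma> = p1"
      using \<gamma>[of 0] by (simp_all add: fun_eq_iff A.map_simps B.map_simps \<phi>_simps)
        (simp add: \<gamma>_def B.p_decomposed)
    with mor bij show "\<exists>\<gamma>. rb_morphism e1 e2 \<gamma> \<and> bij \<gamma> \<and> \<gamma> \<circ> i1 = i2 \<and> p2 \<circ> \<gamma> = p1"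
      by blast
  qed
qed

section \<open>Equivalence of cocycles is an equivalence relation\<close>

text \<open>
  A change of section by \<open>\<phi>\<close> is undone by \<open>- \<phi>\<close>, and two successive changes add up. The operators
  \<open>\<psi>'\<close> in the definition belong to the second cocycle, so both times they have to be
  exchanged for those of another cocycle, at the cost of brackets of values of the changes.
\<close>

lemma nab_equiv_equiv:
  assumes h: "lie_algebra h" and g: "lie_algebra g" and S: "lin h h (rb_op h)"
  shows "equiv (nab_cocycles g h) (nab_equiv g h)"
proof -
  have vs: "vector_space (smul g)" "vector_space (smul h)"
    using g h by (simp_all add: lie_algebra_def)
  have psi_lin: "lin h h (\<psi> x)" if "(\<chi>, \<psi>, \<Phi>) \<in> nab_cocycles g h" for \<chi> \<psi> \<Phi> x
    using that by (simp add: nab_cocycles_def derivation_def Let_def)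
  show ?thesis
  proof (rule equivI)
    show "nab_equiv g h \<subseteq> nab_cocycles g h \<times> nab_cocycles g h"
      by (auto simp: nab_equiv_def)
    show "refl_on (nab_cocycles g h) (nab_equiv g h)"
    proof (rule refl_onI)
      fix c assume c: "c \<in> nab_cocycles g h"
      obtain \<chi> \<psi> \<Phi> where [simp]: "c = (\<chi>, \<psi>, \<Phi>)" by (cases c)
      have "lin g h (\<lambda>_. 0)"
        using lin_zero[OF bracket_lin(1)[OF h]] vs
        by (intro linI) (auto simp: module.scale_zero_right module_iff_vector_space)
      then show "(c, c) \<in> nab_equiv g h"
        using c lin_zero[OF psi_lin, of \<chi> \<psi> \<Phi>] lin_zero[OF S] lin_zero[OF bracket_lin(1)[OF h]]
        by (auto simp: nab_equiv_def intro!: exI[of _ "\<lambda>_. 0"])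
    qed
    show "sym (nab_equiv g h)"
    proof (rule symI)
      fix c c' assume r: "(c, c') \<in> nab_equiv g h"
      obtain \<chi> \<psi> \<Phi> where c: "c = (\<chi>, \<psi>, \<Phi>)" by (cases c)
      obtain \<chi>' \<psi>' \<Phi>' where c': "c' = (\<chi>', \<psi>', \<Phi>')" by (cases c')
      from r obtain \<phi> where co: "(\<chi>, \<psi>, \<Phi>) \<in> nab_cocycles g h" "(\<chi>', \<psi>', \<Phi>') \<in> nab_cocycles g h"
        and \<phi>: "lin g h \<phi>"
        and eqs: "\<And>x a. \<psi> x a - \<psi>' x a = [\<phi> x, a]\<^bsub>h\<^esub>"
         "\<And>x y. \<chi> x y - \<chi>' x y =
          \<psi>' x (\<phi> y) - \<psi>' y (\<phi> x) - \<phi> [x, y]\<^bsub>g\<^esub> + [\<phi> x, \<phi> y]\<^bsub>h\<^esub>"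
         "\<And>x. \<Phi> x - \<Phi>' x = rb_op h (\<phi> x) - \<phi> (rb_op g x)"
        unfolding nab_equiv_def c c' by auto
      have "lin g h (\<lambda>x. - \<phi> x)"
        using vs by (intro linI)
          (simp_all add: lin_simps[OF \<phi>] lin_scale[OF \<phi>] module.scale_minus_right module_iff_vector_space)
      moreover have psi: "\<psi> x a = \<psi>' x a + [\<phi> x, a]\<^bsub>h\<^esub>" for x a
        using eqs(1)[of x a] by (simp add: algebra_simps)
      moreover have "\<chi>' x y - \<chi> x y =
          \<psi> x (- \<phi> y) - \<psi> y (- \<phi> x) - - \<phi> [x, y]\<^bsub>g\<^esub> + [- \<phi> x, - \<phi> y]\<^bsub>h\<^esub>" for x y
        using arg_cong[OF eqs(2)[of x y], of uminus] bracket_swap[OF h, of "\<phi> y" "\<phi> x"]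
        by (simp add: lin_simps[OF psi_lin[OF co(2)]] bracket_simps[OF h] psi algebra_simps)
      moreover have "\<Phi>' x - \<Phi> x = rb_op h (- \<phi> x) - - \<phi> (rb_op g x)" for x
        using arg_cong[OF eqs(3)[of x], of uminus] by (simp add: lin_simps[OF S])
      ultimately show "(c', c) \<in> nab_equiv g h"
        using co unfolding nab_equiv_def c c'
        by (auto simp: bracket_simps[OF h] intro!: exI[of _ "\<lambda>x. - \<phi> x"])
    qed
    show "trans (nab_equiv g h)"
    proof (rule transI)
      fix c c' c'' assume r: "(c, c') \<in> nab_equiv g h" "(c', c'') \<in> nab_equiv g h"
      obtain \<chi> \<psi> \<Phi> where c: "c = (\<chi>, \<psi>, \<Phi>)" by (cases c)
      obtain \<chi>' \<psi>' \<Phi>' where c': "c' = (\<chi>', \<psi>', \<Phi>')" by (cases c')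
      obtain \<chi>'' \<psi>'' \<Phi>'' where c'': "c'' = (\<chi>'', \<psi>'', \<Phi>'')" by (cases c'')
      from r(1) obtain \<phi> where co: "(\<chi>, \<psi>, \<Phi>) \<in> nab_cocycles g h"
        and \<phi>: "lin g h \<phi>"
        and eqs: "\<And>x a. \<psi> x a - \<psi>' x a = [\<phi> x, a]\<^bsub>h\<^esub>"
         "\<And>x y. \<chi> x y - \<chi>' x y =
          \<psi>' x (\<phi> y) - \<psi>' y (\<phi> x) - \<phi> [x, y]\<^bsub>g\<^esub> + [\<phi> x, \<phi> y]\<^bsub>h\<^esub>"
         "\<And>x. \<Phi> x - \<Phi>' x = rb_op h (\<phi> x) - \<phi> (rb_op g x)"
        unfolding nab_equiv_def c c' by auto
      from r(2) obtain \<phi>' where co'': "(\<chi>'', \<psi>'', \<Phi>'') \<in> nab_cocycles g h"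
        and \<phi>': "lin g h \<phi>'"
        and eqs': "\<And>x a. \<psi>' x a - \<psi>'' x a = [\<phi>' x, a]\<^bsub>h\<^esub>"
         "\<And>x y. \<chi>' x y - \<chi>'' x y =
          \<psi>'' x (\<phi>' y) - \<psi>'' y (\<phi>' x) - \<phi>' [x, y]\<^bsub>g\<^esub> + [\<phi>' x, \<phi>' y]\<^bsub>h\<^esub>"
         "\<And>x. \<Phi>' x - \<Phi>'' x = rb_op h (\<phi>' x) - \<phi>' (rb_op g x)"
        unfolding nab_equiv_def c'' c' by auto
      define \<theta> where "\<theta> x = \<phi>' x + \<phi> x" for x
      have "lin g h \<theta>"
        using vs by (intro linI)
          (simp_all add: \<theta>_def lin_simps[OF \<phi>] lin_scale[OF \<phi>] lin_simps[OF \<phi>'] lin_scale[OF \<phi>'] smul_add)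
      moreover have psi': "\<psi>' x a = \<psi>'' x a + [\<phi>' x, a]\<^bsub>h\<^esub>" for x a
        using eqs'(1)[of x a] by (simp add: algebra_simps)
      then have "\<psi> x a - \<psi>'' x a = [\<theta> x, a]\<^bsub>h\<^esub>" for x a
        using eqs(1)[of x a] by (simp add: \<theta>_def bracket_simps[OF h] algebra_simps)
      moreover have "\<chi> x y - \<chi>'' x y =
          \<psi>'' x (\<theta> y) - \<psi>'' y (\<theta> x) - \<theta> [x, y]\<^bsub>g\<^esub> + [\<theta> x, \<theta> y]\<^bsub>h\<^esub>" for x y
      proof -
        have "\<chi> x y - \<chi>'' x y = (\<chi> x y - \<chi>' x y) + (\<chi>' x y - \<chi>'' x y)" by simp
        also have "\<dots> = \<psi>'' x (\<theta> y) - \<psi>'' y (\<theta> x) - \<theta> [x, y]\<^bsub>g\<^esub> + [\<theta> x, \<theta> y]\<^bsub>h\<^esub>"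
          unfolding eqs(2) eqs'(2) \<theta>_def lin_simps[OF psi_lin[OF co'']] bracket_simps[OF h] psi'
            bracket_swap[OF h, of "\<phi> x" "\<phi>' y"]
          by (simp add: algebra_simps)
        finally show ?thesis .
      qed
      moreover have "\<Phi> x - \<Phi>'' x = rb_op h (\<theta> x) - \<theta> (rb_op g x)" for x
        using arg_cong2[OF eqs(3)[of x] eqs'(3)[of x], of "(+)"]
        by (simp add: \<theta>_def lin_simps[OF S] algebra_simps)
      ultimately show "(c, c'') \<in> nab_equiv g h"
        using co co'' unfolding nab_equiv_def c c'' by auto
    qed
  qed
qed

section \<open>Twisting an extension by automorphisms\<close>

lemma rb_Aut_inv:
  assumes "f \<in> rb_Aut L"
  shows "inv f \<in> rb_Aut L"
proof -
  have f: "lin L L f" "\<And>x y. f [x, y]\<^bsub>L\<^esub> = [f x, f y]\<^bsub>L\<^esub>" "\<And>x. rb_op L (f x) = f (rb_op L x)"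
    and bij: "bij f"
    using assms by (auto simp: rb_Aut_def rb_morphism_def fun_eq_iff)
  have ff: "f (inv f x) = x" for x
    using bij by (simp add: bij_is_surj surj_f_inv_f)
  have eqI: "a = b" if "f a = f b" for a b
    by (rule injD[OF bij_is_inj[OF bij] that])
  have "lin L L (inv f)"
    by (rule linI[OF lin_vector_space[OF f(1)]]; rule eqI)
      (simp_all add: ff lin_add[OF f(1)] lin_scale[OF f(1)])
  moreover have "inv f [x, y]\<^bsub>L\<^esub> = [inv f x, inv f y]\<^bsub>L\<^esub>" for x y
    by (rule eqI) (simp add: f ff)
  moreover have "rb_op L (inv f x) = inv f (rb_op L x)" for x
    by (rule eqI) (simp add: f(3)[symmetric] ff)
  ultimately show ?thesis
    using bij by (simp add: rb_Aut_def rb_morphism_def bij_imp_bij_inv fun_eq_iff)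
qed

lemma rb_morphism_comp: "rb_morphism L M f \<Longrightarrow> rb_morphism M N f' \<Longrightarrow> rb_morphism L N (f' \<circ> f)"
  using Vector_Spaces.linear_compose[of "smul L" "smul M" f "smul N" f']
  by (simp add: rb_morphism_def fun_eq_iff)

context sectioned_extension
begin

lemma twisted_extension:
  assumes \<alpha>: "\<alpha> \<in> rb_Aut g" and \<beta>: "\<beta> \<in> rb_Aut h"
  shows "sectioned_extension g h e (i \<circ> inv \<beta>) (\<alpha> \<circ> p) (s \<circ> inv \<alpha>)"
proof
  have bij: "bij \<alpha>" "bij \<beta>" and \<alpha>m: "rb_morphism g g \<alpha>" and \<alpha>l: "lin g g \<alpha>"
    using \<alpha> \<beta> by (simp_all add: rb_Aut_def rb_morphism_def)
  have inv: "rb_morphism h h (inv \<beta>)" "lin g g (inv \<alpha>)"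
    using rb_Aut_inv[OF \<alpha>] rb_Aut_inv[OF \<beta>] by (simp_all add: rb_Aut_def rb_morphism_def)
  have \<alpha>0: "\<alpha> x = 0 \<longleftrightarrow> x = 0" for x
    using inj_eq[OF bij_is_inj[OF bij(1)], of x 0] by (simp add: lin_zero[OF \<alpha>l])
  have E: "rb_lie_algebra g" "rb_lie_algebra h" "rb_lie_algebra e"
    "rb_morphism h e i" "rb_morphism e g p" "inj i" "range i = {u. p u = 0}" "surj p"
    using extension unfolding rb_extension_def by blast+
  have "inj (i \<circ> inv \<beta>)"
    by (rule inj_compose[OF E(6) bij_is_inj[OF bij_imp_bij_inv[OF bij(2)]]])
  moreover have "range (i \<circ> inv \<beta>) = {u. (\<alpha> \<circ> p) u = 0}"
    unfolding image_comp[of i "inv \<beta>" UNIV, symmetric] bij_is_surj[OF bij_imp_bij_inv[OF bij(2)]]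
      E(7) o_apply \<alpha>0
    by (rule refl)
  moreover have "surj (\<alpha> \<circ> p)"
    by (rule comp_surj[OF E(8) bij_is_surj[OF bij(1)]])
  ultimately show "rb_extension g h e (i \<circ> inv \<beta>) (\<alpha> \<circ> p)"
    unfolding rb_extension_def
    using E(1-3) rb_morphism_comp[OF inv(1) E(4)] rb_morphism_comp[OF E(5) \<alpha>m] by blast
  have "(\<alpha> \<circ> p) \<circ> (s \<circ> inv \<alpha>) = id"
    by (rule ext) (simp add: p_s surj_f_inv_f[OF bij_is_surj[OF bij(1)]])
  then show "is_section g e (\<alpha> \<circ> p) (s \<circ> inv \<alpha>)"
    unfolding is_section_def
    using Vector_Spaces.linear_compose[OF inv(2) lins(6)] by blast
qed

text \<open>
  In the twisted extension the identification of the kernel with \<open>h\<close> is \<open>\<beta>\<close> after the old one, and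
  \<open>x\<close> is lifted to \<open>s (\<alpha>\<^sup>-\<^sup>1 x)\<close>; substituting both in the definition gives the twist.
\<close>

lemma induced_cocycle_twisted:
  assumes \<alpha>: "\<alpha> \<in> rb_Aut g" and \<beta>: "\<beta> \<in> rb_Aut h"
  shows "induced_cocycle g e (i \<circ> inv \<beta>) (s \<circ> inv \<alpha>) = twist \<beta> \<alpha> (induced_cocycle g e i s)"
proof -
  interpret twisted: sectioned_extension g h e "i \<circ> inv \<beta>" "\<alpha> \<circ> p" "s \<circ> inv \<alpha>"
    using assms by (rule twisted_extension)
  have inv\<beta>: "inv \<beta> (\<beta> a) = a" for a
    using \<beta> by (simp add: rb_Aut_def bij_is_inj)
  have "inv \<alpha> \<in> rb_Aut g" by (rule rb_Aut_inv[OF \<alpha>])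
  then have inv\<alpha>: "inv \<alpha> [x, y]\<^bsub>g\<^esub> = [inv \<alpha> x, inv \<alpha> y]\<^bsub>g\<^esub>"
    "inv \<alpha> (T x) = T (inv \<alpha> x)" for x y
    by (simp_all add: rb_Aut_def rb_morphism_def fun_eq_iff)
  have "twisted.chi x y = \<beta> (chi (inv \<alpha> x) (inv \<alpha> y))" for x y
    unfolding twisted.i_eq_iff[symmetric] twisted.i_chi by (simp add: i_chi inv\<alpha> inv\<beta>)
  moreover have "twisted.psi x a = \<beta> (psi (inv \<alpha> x) (inv \<beta> a))" for x a
    unfolding twisted.i_eq_iff[symmetric] twisted.i_psi by (simp add: i_psi inv\<beta>)
  moreover have "twisted.Phi x = \<beta> (Phi (inv \<alpha> x))" for x
    unfolding twisted.i_eq_iff[symmetric] twisted.i_Phi by (simp add: i_Phi inv\<alpha> inv\<beta>)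
  ultimately show ?thesis
    unfolding induced_cocycle_eq twisted.induced_cocycle_eq twist_def prod.case
    by (intro arg_cong2[where f = Pair] ext)
qed

text \<open>
  The condition on all sections becomes \<open>p \<circ> \<gamma> = \<alpha> \<circ> p\<close> because \<open>p \<circ> \<gamma>\<close> vanishes on the range of
  \<open>i\<close>, hence is determined by its values on the complement \<open>s(g)\<close>.
\<close>

lemma inducible_iff_isomorphic:
  assumes \<beta>: "bij \<beta>"
  shows "inducible g e i p \<beta> \<alpha> \<longleftrightarrow>
    (\<exists>\<gamma>. rb_morphism e e \<gamma> \<and> bij \<gamma> \<and> \<gamma> \<circ> (i \<circ> inv \<beta>) = i \<and> p \<circ> \<gamma> = \<alpha> \<circ> p)"
proof -
  have i_comp: "\<gamma> \<circ> (i \<circ> inv \<beta>) = i \<longleftrightarrow> \<gamma> \<circ> i = i \<circ> \<beta>" for \<gamma> :: "'e \<Rightarrow> 'e"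
  proof
    assume "\<gamma> \<circ> (i \<circ> inv \<beta>) = i"
    then have "\<gamma> (i (inv \<beta> (\<beta> a))) = i (\<beta> a)" for a by (simp add: fun_eq_iff)
    then show "\<gamma> \<circ> i = i \<circ> \<beta>" using \<beta> by (simp add: fun_eq_iff bij_is_inj)
  next
    assume "\<gamma> \<circ> i = i \<circ> \<beta>"
    then show "\<gamma> \<circ> (i \<circ> inv \<beta>) = i"
      using \<beta> by (simp add: fun_eq_iff bij_is_surj surj_f_inv_f)
  qed
  have p_comp: "(\<forall>t. is_section g e p t \<longrightarrow> p \<circ> \<gamma> \<circ> t = \<alpha>) \<longleftrightarrow> p \<circ> \<gamma> = \<alpha> \<circ> p"
    if \<gamma>: "lin e e \<gamma>" and \<gamma>i: "\<gamma> \<circ> i = i \<circ> \<beta>" for \<gamma>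
  proof
    assume "\<forall>t. is_section g e p t \<longrightarrow> p \<circ> \<gamma> \<circ> t = \<alpha>"
    then have \<gamma>s: "p (\<gamma> (s x)) = \<alpha> x" for x
      using sectioned by (auto simp: fun_eq_iff)
    have p\<gamma>i: "p (\<gamma> (i a)) = 0" for a
      using \<gamma>i by (simp add: fun_eq_iff p_i)
    have "p (\<gamma> u) = \<alpha> (p u)" for u
    proof -
      have "p (\<gamma> u) = p (\<gamma> (s (p u) + i (proj u)))" by (simp only: decompose)
      also have "\<dots> = \<alpha> (p u)"
        by (simp add: lin_add[OF \<gamma>] map_simps \<gamma>s p\<gamma>i)
      finally show ?thesis .
    qed
    then show "p \<circ> \<gamma> = \<alpha> \<circ> p"
      by (simp add: fun_eq_iff)
  qed (simp add: is_section_def fun_eq_iff)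
  have range: "\<gamma> ` range i \<subseteq> range i" if "\<gamma> \<circ> i = i \<circ> \<beta>" for \<gamma>
    using that by (auto simp: fun_eq_iff)
  show ?thesis
  proof
    assume "inducible g e i p \<beta> \<alpha>"
    then obtain \<gamma> where "rb_morphism e e \<gamma>" "bij \<gamma>" "\<gamma> \<circ> i = i \<circ> \<beta>"
      "\<forall>t. is_section g e p t \<longrightarrow> p \<circ> \<gamma> \<circ> t = \<alpha>"
      unfolding inducible_def rb_Aut_def by blast
    moreover from this have "lin e e \<gamma>" by (simp add: rb_morphism_def)
    ultimately show "\<exists>\<gamma>. rb_morphism e e \<gamma> \<and> bij \<gamma> \<and> \<gamma> \<circ> (i \<circ> inv \<beta>) = i \<and> p \<circ> \<gamma> = \<alpha> \<circ> p"
      using i_comp p_comp by blast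
  next
    assume "\<exists>\<gamma>. rb_morphism e e \<gamma> \<and> bij \<gamma> \<and> \<gamma> \<circ> (i \<circ> inv \<beta>) = i \<and> p \<circ> \<gamma> = \<alpha> \<circ> p"
    then obtain \<gamma> where \<gamma>: "rb_morphism e e \<gamma>" "bij \<gamma>" "\<gamma> \<circ> i = i \<circ> \<beta>" "p \<circ> \<gamma> = \<alpha> \<circ> p"
      using i_comp by blast
    then have "lin e e \<gamma>" by (simp add: rb_morphism_def)
    with \<gamma> p_comp range show "inducible g e i p \<beta> \<alpha>"
      unfolding inducible_def rb_Aut_def by blast
  qed
qed

end

theorem theorem4p3:
  fixes g :: "('k::field_char_0, 'g::ab_group_add) rb_lie"
    and h :: "('k, 'h::ab_group_add) rb_lie"
    and e :: "('k, 'e::ab_group_add) rb_lie"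
    and i :: "'h \<Rightarrow> 'e" and p :: "'e \<Rightarrow> 'g" and s :: "'g \<Rightarrow> 'e"
    and \<alpha> :: "'g \<Rightarrow> 'g" and \<beta> :: "'h \<Rightarrow> 'h"
    and \<chi> :: "'g \<Rightarrow> 'g \<Rightarrow> 'h" and \<psi> :: "'g \<Rightarrow> 'h \<Rightarrow> 'h" and \<Phi> :: "'g \<Rightarrow> 'h"
  assumes "rb_extension g h e i p"
    and "is_section g e p s"
    and "(\<chi>, \<psi>, \<Phi>) = induced_cocycle g e i s"
    and "(\<beta>, \<alpha>) \<in> rb_Aut h \<times> rb_Aut g"
  shows "(inducible g e i p \<beta> \<alpha> \<longleftrightarrow>
            (twist \<beta> \<alpha> (\<chi>, \<psi>, \<Phi>), (\<chi>, \<psi>, \<Phi>)) \<in> nab_equiv g h) \<and>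
         (inducible g e i p \<beta> \<alpha> \<longleftrightarrow>
            (\<exists>\<xi> \<in> H2_nab g h. twist \<beta> \<alpha> (\<chi>, \<psi>, \<Phi>) \<in> \<xi> \<and> (\<chi>, \<psi>, \<Phi>) \<in> \<xi>))"
proof -
  interpret sectioned_extension g h e i p s
    using assms(1,2) by unfold_locales
  have \<alpha>: "\<alpha> \<in> rb_Aut g" and \<beta>: "\<beta> \<in> rb_Aut h" "bij \<beta>"
    using assms(4) by (simp_all add: rb_Aut_def)
  have eqv: "equiv (nab_cocycles g h) (nab_equiv g h)"
    using lie lins(2) by (intro nab_equiv_equiv)
  have "inducible g e i p \<beta> \<alpha> \<longleftrightarrow>
      (twist \<beta> \<alpha> (\<chi>, \<psi>, \<Phi>), (\<chi>, \<psi>, \<Phi>)) \<in> nab_equiv g h"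
    unfolding inducible_iff_isomorphic[OF \<beta>(2)] assms(3) induced_cocycle_twisted[OF \<alpha> \<beta>(1), symmetric]
    by (rule isomorphic_iff_nab_equiv[OF twisted_extension[OF \<alpha> \<beta>(1)] sectioned_extension_axioms])
  moreover have "(c, c') \<in> nab_equiv g h \<longleftrightarrow> (\<exists>\<xi> \<in> H2_nab g h. c \<in> \<xi> \<and> c' \<in> \<xi>)" for c c'
  proof
    assume cc': "(c, c') \<in> nab_equiv g h"
    then have "c \<in> nab_cocycles g h"
      unfolding nab_equiv_def by blast
    then have "nab_equiv g h `` {c} \<in> H2_nab g h" "c \<in> nab_equiv g h `` {c}"
      unfolding H2_nab_def by (rule quotientI, rule equiv_class_self[OF eqv])
    with cc' show "\<exists>\<xi> \<in> H2_nab g h. c \<in> \<xi> \<and> c' \<in> \<xi>" by blast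
  next
    assume "\<exists>\<xi> \<in> H2_nab g h. c \<in> \<xi> \<and> c' \<in> \<xi>"
    then obtain \<xi> where "\<xi> \<in> nab_cocycles g h // nab_equiv g h" "c \<in> \<xi>" "c' \<in> \<xi>"
      unfolding H2_nab_def by blast
    then show "(c, c') \<in> nab_equiv g h"
      using quotient_eq_iff[OF eqv, of \<xi> \<xi> c c'] by simp
  qed
  ultimately show ?thesis by simp
qed

end
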